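(* Let $M^3=\mathsf{E}/\Gamma$ be a Margulis spacetime whose associated complete hyperbolic surface $\Sigma=\mathsf{H}^2/\mathsf{L}(\Gamma)$ has compact convex core, and let $\Lambda\subset\partial\mathsf{H}^2$ be the limit set of $\mathsf{L}(\Gamma)$. Then null geodesics of $M$ that are not parallel to a point of $\Lambda$ do not recur: if $\mathsf{v}\in\mathsf{V}$ is a nonzero null vector whose line $\mathbb{R}\mathsf{v}\in\partial\mathsf{H}^2$ does not belong to $\Lambda$, then for every $p\in\mathsf{E}$ the point $[(p,\mathsf{v})]\in\mathsf{T}_0(M)$ is not recurrent for the geodesic flow $\psi$.
   Context: A Margulis spacetime is a (geodesically) complete flat affine $3$-manifold $M^3$ with free nonabelian fundamental group. Thus $M=\mathsf{E}/\Gamma$, where $\mathsf{E}$ is a $3$-dimensional affine space with vector space of translations $\mathsf{V}$, and $\Gamma\cong\pi_1(M)$ is a discrete group of affine transformations acting properly and freely on $\mathsf{E}$. For an affine map $\gamma(p)=A(p)+b$ write $\mathsf{L}(\gamma)=A$ for its linear part. It is known that there is a Lorentzian inner product $\langle\cdot,\cdot\rangle$ of signature $(2,1)$ on $\mathsf{V}$ for which $\mathsf{L}$ embeds $\Gamma$ as a discrete subgroup of $\mathsf{SO}(2,1)$; fix it. The group $\mathsf{L}(\Gamma)$ acts properly and freely on the hyperbolic plane $\mathsf{H}^2$ (the projectivization of $\{\mathsf{v}\in\mathsf{V}:\langle \mathsf{v},\mathsf{v}\rangle=-1\}$), and $\Sigma=\mathsf{H}^2/\mathsf{L}(\Gamma)$.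 The ideal boundary $\partial\mathsf{H}^2$ is the set of null lines in $\mathsf{V}$. Let $\mathsf{T}_0(M)=(\mathsf{E}\times\mathsf{S}_0)/\Gamma$, where $\mathsf{S}_0$ is here the set of nonzero $\mathsf{v}\in\mathsf{V}$ with $\langle\mathsf{v},\mathsf{v}\rangle=0$ and $\gamma\in\Gamma$ acts by $(p,\mathsf{v})\mapsto(\gamma p,\mathsf{L}(\gamma)\mathsf{v})$. The geodesic flow $\psi$ on $\mathsf{T}_0(M)$ is induced by $\tilde\psi_t(p,\mathsf{v})=(p+t\mathsf{v},\mathsf{v})$. Convention on recurrence: for a flow $\phi_t$ on a space $Y$, a point $x\in Y$ is called recurrent if it is nonwandering in both time directions, i.e. for every neighborhood $U$ of $x$ and every $T>0$ there are $t\ge T$ and $t'\le -T$ with $\phi_t(U)\cap U\neq\emptyset$ and $\phi_{t'}(U)\cap U\neq\emptyset$. *)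

theory Defs
  imports "HOL-Analysis.Analysis" "HOL-Algebra.Bij" "HOL-Algebra.Generated_Groups"
begin

section \<open>Quotient topologies and orbit spaces\<close>

definition quotient_topology :: "'a topology \<Rightarrow> ('a \<Rightarrow> 'b) \<Rightarrow> 'b topology" where
  "quotient_topology X q =
     topology (\<lambda>U. U \<subseteq> q ` topspace X \<and> openin X {x \<in> topspace X. q x \<in> U})"

lemma openin_quotient_topology:
  "openin (quotient_topology X q) U \<longleftrightarrow>
     U \<subseteq> q ` topspace X \<and> openin X {x \<in> topspace X. q x \<in> U}"
proof -
  have "istopology (\<lambda>U. U \<subseteq> q ` topspace X \<and> openin X {x \<in> topspace X. q x \<in> U})"
    unfolding istopology_def
  proof (intro conjI allI impI)
    fix S T
    assume "S \<subseteq> q ` topspace X \<and> openin X {x \<in> topspace X. q x \<in> S}"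
      "T \<subseteq> q ` topspace X \<and> openin X {x \<in> topspace X. q x \<in> T}"
    then have "openin X ({x \<in> topspace X. q x \<in> S} \<inter> {x \<in> topspace X. q x \<in> T})"
      by blast
    moreover have "{x \<in> topspace X. q x \<in> S} \<inter> {x \<in> topspace X. q x \<in> T}
        = {x \<in> topspace X. q x \<in> S \<inter> T}" by auto
    ultimately show "openin X {x \<in> topspace X. q x \<in> S \<inter> T}" by simp
  next
    fix K
    assume K: "\<forall>U\<in>K. U \<subseteq> q ` topspace X \<and> openin X {x \<in> topspace X. q x \<in> U}"
    then have "openin X (\<Union>U\<in>K. {x \<in> topspace X. q x \<in> U})" by blast
    moreover have "(\<Union>U\<in>K. {x \<in> topspace X. q x \<in> U})
        = {x \<in> topspace X. q x \<in> \<Union>K}" by auto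
    ultimately show "openin X {x \<in> topspace X. q x \<in> \<Union>K}" by simp
  qed auto
  then show ?thesis by (simp add: quotient_topology_def topology_inverse')
qed

lemma topspace_quotient_topology: "topspace (quotient_topology X q) = q ` topspace X"
proof -
  have "openin (quotient_topology X q) (q ` topspace X)"
  proof -
    have "{x \<in> topspace X. q x \<in> q ` topspace X} = topspace X" by auto
    then show ?thesis by (simp add: openin_quotient_topology)
  qed
  then show ?thesis
    by (meson openin_quotient_topology openin_subset openin_topspace subset_antisym)
qed

lemma quotient_map_quotient_topology: "quotient_map X (quotient_topology X q) q"
  by (simp add: quotient_map_def openin_quotient_topology topspace_quotient_topology)

text \<open>The orbit of a point under a set \<open>G\<close> of transformations acting by \<open>act\<close>; for a group
  \<open>G\<close>, the map \<open>orbit G act\<close> is the projection to the orbit space.\<close>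

definition orbit :: "'g set \<Rightarrow> ('g \<Rightarrow> 'a \<Rightarrow> 'a) \<Rightarrow> 'a \<Rightarrow> 'a set" where
  "orbit G act x = (\<lambda>g. act g x) ` G"


section \<open>Recurrence\<close>

definition recurrent :: "'a topology \<Rightarrow> (real \<Rightarrow> 'a \<Rightarrow> 'a) \<Rightarrow> 'a \<Rightarrow> bool" where
  "recurrent Y \<phi> x \<longleftrightarrow>
     x \<in> topspace Y \<and>
     (\<forall>U T. openin Y U \<and> x \<in> U \<and> T > 0 \<longrightarrow>
        (\<exists>t\<ge>T. \<phi> t ` U \<inter> U \<noteq> {}) \<and> (\<exists>t'\<le>-T. \<phi> t' ` U \<inter> U \<noteq> {}))"


section \<open>Free groups\<close>

text \<open>A word is a list of pairs \<open>(s, e)\<close>, standing for \<open>s\<close> if \<open>e\<close> holds and for the inverse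
  of \<open>s\<close> otherwise.\<close>

definition reduced_word :: "('a \<times> bool) list \<Rightarrow> bool" where
  "reduced_word w \<longleftrightarrow> successively (\<lambda>(s, e) (s', e'). \<not> (s = s' \<and> e \<noteq> e')) w"

definition word_value :: "('a, 'b) monoid_scheme \<Rightarrow> ('a \<times> bool) list \<Rightarrow> 'a" where
  "word_value G w =
     foldr (\<lambda>(s, e) x. (if e then s else inv\<^bsub>G\<^esub> s) \<otimes>\<^bsub>G\<^esub> x) w \<one>\<^bsub>G\<^esub>"

definition free_basis :: "('a, 'b) monoid_scheme \<Rightarrow> 'a set \<Rightarrow> bool" where
  "free_basis G S \<longleftrightarrow>
     S \<subseteq> carrier G \<and> generate G S = carrier G \<and>
     (\<forall>w. fst ` set w \<subseteq> S \<and> reduced_word w \<and> w \<noteq> [] \<longrightarrow> word_value G w \<noteq> \<one>\<^bsub>G\<^esub>)"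

definition free_group :: "('a, 'b) monoid_scheme \<Rightarrow> bool" where
  "free_group G \<longleftrightarrow> group G \<and> (\<exists>S. free_basis G S)"


section \<open>Margulis spacetimes\<close>

text \<open>A choice of origin identifies the affine space with its space of translations; both are
  \<^typ>\<open>real^3\<close>. A quotient \<open>M\<close> is given by its group of affine deck transformations, which is
  the fundamental group of \<open>M\<close>.\<close>

definition affine_map :: "(real^3 \<Rightarrow> real^3) \<Rightarrow> bool" where
  "affine_map \<gamma> \<longleftrightarrow> (\<exists>(A :: real^3^3) b. \<forall>p. \<gamma> p = A *v p + b)"

definition linear_part :: "(real^3 \<Rightarrow> real^3) \<Rightarrow> real^3^3" where
  "linear_part \<gamma> = matrix (\<lambda>v. \<gamma> v - \<gamma> 0)"

lemma linear_part_affine: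
  assumes "\<And>p. \<gamma> p = A *v p + b"
  shows "linear_part \<gamma> = A"
  using assms by (simp add: linear_part_def)

definition acts_freely :: "('a \<Rightarrow> 'a) set \<Rightarrow> bool" where
  "acts_freely \<Gamma> \<longleftrightarrow> (\<forall>\<gamma>\<in>\<Gamma>. \<forall>p. \<gamma> p = p \<longrightarrow> \<gamma> = id)"

text \<open>Properness for a discrete group.\<close>

definition acts_properly :: "('a::topological_space \<Rightarrow> 'a) set \<Rightarrow> bool" where
  "acts_properly \<Gamma> \<longleftrightarrow> (\<forall>K. compact K \<longrightarrow> finite {\<gamma> \<in> \<Gamma>. \<gamma> ` K \<inter> K \<noteq> {}})"

text \<open>Discreteness refers to the topology of the affine group given by the linear and
  translational parts.\<close>

definition margulis_spacetime :: "(real^3 \<Rightarrow> real^3) set \<Rightarrow> bool" where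
  "margulis_spacetime \<Gamma> \<longleftrightarrow>
     subgroup \<Gamma> (BijGroup UNIV) \<and>
     (\<forall>\<gamma>\<in>\<Gamma>. affine_map \<gamma>) \<and>
     discrete ((\<lambda>\<gamma>. (linear_part \<gamma>, \<gamma> 0)) ` \<Gamma>) \<and>
     acts_properly \<Gamma> \<and> acts_freely \<Gamma> \<and>
     free_group ((BijGroup UNIV)\<lparr>carrier := \<Gamma>\<rparr>) \<and>
     \<not> comm_group ((BijGroup UNIV)\<lparr>carrier := \<Gamma>\<rparr>)"


section \<open>Lorentzian inner products and the hyperbolic plane\<close>

definition lorentzian :: "(real^3 \<Rightarrow> real^3 \<Rightarrow> real) \<Rightarrow> bool" where
  "lorentzian B \<longleftrightarrow>
     bilinear B \<and> (\<forall>u v. B u v = B v u) \<and>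
     (\<exists>e\<^sub>1 e\<^sub>2 e\<^sub>3. span {e\<^sub>1, e\<^sub>2, e\<^sub>3} = UNIV \<and>
        B e\<^sub>1 e\<^sub>1 = 1 \<and> B e\<^sub>2 e\<^sub>2 = 1 \<and> B e\<^sub>3 e\<^sub>3 = -1 \<and>
        B e\<^sub>1 e\<^sub>2 = 0 \<and> B e\<^sub>1 e\<^sub>3 = 0 \<and> B e\<^sub>2 e\<^sub>3 = 0)"

definition SO_form :: "(real^3 \<Rightarrow> real^3 \<Rightarrow> real) \<Rightarrow> (real^3^3) set" where
  "SO_form B = {A. (\<forall>u v. B (A *v u) (A *v v) = B u v) \<and> det A = 1}"

definition discretely_embedded_linear_part ::
    "(real^3 \<Rightarrow> real^3 \<Rightarrow> real) \<Rightarrow> (real^3 \<Rightarrow> real^3) set \<Rightarrow> bool" where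
  "discretely_embedded_linear_part B \<Gamma> \<longleftrightarrow>
     inj_on linear_part \<Gamma> \<and> linear_part ` \<Gamma> \<subseteq> SO_form B \<and> discrete (linear_part ` \<Gamma>)"

text \<open>Points of the projective plane are lines through the origin.\<close>

definition projective_plane :: "(real^3) set topology" where
  "projective_plane = quotient_topology (top_of_set (- {0})) (\<lambda>v. span {v})"

definition hyperbolic_plane :: "(real^3 \<Rightarrow> real^3 \<Rightarrow> real) \<Rightarrow> (real^3) set set" where
  "hyperbolic_plane B = {span {v} |v. B v v = -1}"

definition ideal_boundary :: "(real^3 \<Rightarrow> real^3 \<Rightarrow> real) \<Rightarrow> (real^3) set set" where
  "ideal_boundary B = {span {v} |v. v \<noteq> 0 \<and> B v v = 0}"

definition line_action :: "real^3^3 \<Rightarrow> (real^3) set \<Rightarrow> (real^3) set" where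
  "line_action A l = (\<lambda>v. A *v v) ` l"

definition limit_set ::
    "(real^3 \<Rightarrow> real^3 \<Rightarrow> real) \<Rightarrow> (real^3^3) set \<Rightarrow> (real^3) set set" where
  "limit_set B G =
     {l \<in> ideal_boundary B.
        \<exists>x \<in> hyperbolic_plane B. l \<in> projective_plane derived_set_of (orbit G line_action x)}"

text \<open>Convexity in the closed disc formed by the hyperbolic plane and its ideal boundary, where
  geodesics are projective segments (Klein model). If nonzero \<open>u\<close>, \<open>v\<close> span points of the closed
  disc and \<open>B u v \<le> 0\<close>, then \<open>u\<close> and \<open>v\<close> lie in the same half of the light cone (or are parallel
  null vectors), so the lines spanned by \<open>s u + t v\<close> with \<open>s, t \<ge> 0\<close> form the geodesic segment
  between them.\<close>

definition hyperbolically_convex ::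
    "(real^3 \<Rightarrow> real^3 \<Rightarrow> real) \<Rightarrow> (real^3) set set \<Rightarrow> bool" where
  "hyperbolically_convex B C \<longleftrightarrow>
     C \<subseteq> hyperbolic_plane B \<union> ideal_boundary B \<and>
     (\<forall>u v s t. u \<noteq> 0 \<and> v \<noteq> 0 \<and> span {u} \<in> C \<and> span {v} \<in> C \<and> B u v \<le> 0 \<and>
        s \<ge> 0 \<and> t \<ge> 0 \<and> s *\<^sub>R u + t *\<^sub>R v \<noteq> 0 \<longrightarrow> span {s *\<^sub>R u + t *\<^sub>R v} \<in> C)"

definition hyperbolic_surface ::
    "(real^3 \<Rightarrow> real^3 \<Rightarrow> real) \<Rightarrow> (real^3^3) set \<Rightarrow> (real^3) set set topology" where
  "hyperbolic_surface B G =
     quotient_topology (subtopology projective_plane (hyperbolic_plane B)) (orbit G line_action)"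

definition convex_core ::
    "(real^3 \<Rightarrow> real^3 \<Rightarrow> real) \<Rightarrow> (real^3^3) set \<Rightarrow> (real^3) set set set" where
  "convex_core B G =
     orbit G line_action `
       (hyperbolic_plane B \<inter> (hyperbolically_convex B hull limit_set B G))"


section \<open>The null geodesic flow\<close>

definition null_vectors :: "(real^3 \<Rightarrow> real^3 \<Rightarrow> real) \<Rightarrow> (real^3) set" where
  "null_vectors B = {v. v \<noteq> 0 \<and> B v v = 0}"

definition tangent_action ::
    "(real^3 \<Rightarrow> real^3) \<Rightarrow> (real^3) \<times> (real^3) \<Rightarrow> (real^3) \<times> (real^3)" where
  "tangent_action \<gamma> = (\<lambda>(p, v). (\<gamma> p, linear_part \<gamma> *v v))"

definition null_bundle ::
    "(real^3 \<Rightarrow> real^3 \<Rightarrow> real) \<Rightarrow> (real^3 \<Rightarrow> real^3) set \<Rightarrow> ((real^3) \<times> (real^3)) set topology" where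
  "null_bundle B \<Gamma> =
     quotient_topology (top_of_set (UNIV \<times> null_vectors B)) (orbit \<Gamma> tangent_action)"

definition lifted_flow :: "real \<Rightarrow> (real^3) \<times> (real^3) \<Rightarrow> (real^3) \<times> (real^3)" where
  "lifted_flow t = (\<lambda>(p, v). (p + t *\<^sub>R v, v))"

text \<open>Points of the null bundle are orbits, and the lifted flow maps orbits to orbits, so the
  induced flow takes images.\<close>

definition geodesic_flow :: "real \<Rightarrow> ((real^3) \<times> (real^3)) set \<Rightarrow> ((real^3) \<times> (real^3)) set" where
  "geodesic_flow t X = lifted_flow t ` X"

lemma geodesic_flow_orbit:
  assumes "\<forall>\<gamma>\<in>\<Gamma>. affine_map \<gamma>"
  shows "geodesic_flow t (orbit \<Gamma> tangent_action x) = orbit \<Gamma> tangent_action (lifted_flow t x)"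
proof -
  have "lifted_flow t (tangent_action \<gamma> x) = tangent_action \<gamma> (lifted_flow t x)" if "\<gamma> \<in> \<Gamma>" for \<gamma>
  proof -
    obtain A :: "real^3^3" and b where \<gamma>: "\<And>p. \<gamma> p = A *v p + b"
      using assms \<open>\<gamma> \<in> \<Gamma>\<close> unfolding affine_map_def by blast
    show ?thesis
      by (simp add: lifted_flow_def tangent_action_def linear_part_affine[OF \<gamma>] split_def \<gamma>
          matrix_vector_right_distrib matrix_vector_mult_scaleR algebra_simps)
  qed
  then show ?thesis by (simp add: geodesic_flow_def orbit_def image_image)
qed

end

theory Submission
  imports Defs
begin

text \<open>If \<open>[(p, v)]\<close> is recurrent, there are \<open>t\<^sub>n \<rightarrow> \<infinity>\<close> and \<open>\<gamma>\<^sub>n\<close> in the group carrying points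
  near \<open>(p, v)\<close>, flowed for time \<open>t\<^sub>n\<close>, back near \<open>(p, v)\<close>. As the flowed base points escape to
  infinity, the \<open>\<gamma>\<^sub>n\<close> leave every finite set, while their linear parts nearly fix the null line
  of \<open>v\<close>. But the linear parts act properly discontinuously on the ideal boundary away from the
  limit set, so \<open>v\<close> spans a limit point.\<close>

section \<open>Discrete matrix groups preserving a Lorentzian form\<close>

lemma norm_matrix_vector_mult_le:
  fixes A :: "real^'n^'m"
  shows "norm (A *v x) \<le> norm A * norm x"
proof -
  have "norm (A *v x) = L2_set (\<lambda>i. \<bar>A $ i \<bullet> x\<bar>) UNIV"
    by (simp add: norm_vec_def matrix_vector_mul_component)
  also have "\<dots> \<le> L2_set (\<lambda>i. norm (A $ i) * norm x) UNIV"
    by (intro L2_set_mono Cauchy_Schwarz_ineq2) auto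
  also have "\<dots> = norm A * norm x"
    by (simp add: norm_vec_def L2_set_left_distrib)
  finally show ?thesis .
qed

text \<open>Every entry is at most the operator norm, and the Euclidean norms of rows and columns
  are estimated by sums. The constant is crude; any constant depending only on the dimensions
  suffices.\<close>

lemma norm_matrix_le:
  fixes A :: "real^'n^'m"
  assumes "\<And>u. norm (A *v u) \<le> K * norm u"
  shows "norm A \<le> real CARD('m) * real CARD('n) * K"
proof -
  have comp: "\<bar>A $ i $ j\<bar> \<le> K" for i j
  proof -
    have "\<bar>A $ i $ j\<bar> \<le> onorm ((*v) A)" by (rule matrix_component_le_onorm)
    also have "\<dots> \<le> K" by (rule onorm_le) (use assms in auto)
    finally show ?thesis .
  qed
  have row: "norm (A $ i) \<le> real CARD('n) * K" for i
    using norm_le_l1_cart[of "A $ i"] sum_bounded_above[of UNIV "\<lambda>j. \<bar>A $ i $ j\<bar>" K] comp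
    by fastforce
  have "norm A \<le> (\<Sum>i\<in>UNIV. norm (A $ i))"
    by (simp add: norm_vec_def L2_set_le_sum)
  also have "\<dots> \<le> real CARD('m) * (real CARD('n) * K)"
    using sum_bounded_above[of UNIV "\<lambda>i. norm (A $ i)"] row by fastforce
  finally show ?thesis by (simp add: mult.assoc)
qed

section \<open>Algebra of Lorentzian forms\<close>

lemma lorentzian_bilinear: "lorentzian B \<Longrightarrow> bilinear B"
  by (simp add: lorentzian_def)

lemma lorentzian_commute: "lorentzian B \<Longrightarrow> B u v = B v u"
  by (simp add: lorentzian_def)

text \<open>Reversing the sign of \<open>B\<close> along a timelike unit vector \<open>x\<close> gives a Euclidean inner product.\<close>

lemma lorentzian_positive_definite:
  assumes "lorentzian B"
  obtains x c where "B x x = -1" "c > 0"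
    "\<And>u. c * (norm u)\<^sup>2 \<le> B u u + 2 * (B u x)\<^sup>2"
proof -
  obtain e1 e2 e3 where sp: "span {e1, e2, e3} = UNIV"
    and B11: "B e1 e1 = 1" and B22: "B e2 e2 = 1" and B33: "B e3 e3 = -1"
    and B12: "B e1 e2 = 0" and B13: "B e1 e3 = 0" and B23: "B e2 e3 = 0"
    using assms unfolding lorentzian_def by blast
  note bil = lorentzian_bilinear[OF assms]
  note sym = lorentzian_commute[OF assms]
  \<comment> \<open>With \<open>m\<close> the sum of the absolute coordinates of \<open>u\<close>,
    the triangle inequality gives \<open>norm u \<le> m * N\<close>, and \<open>m\<close> squared is
    at most three times the sum of the squared coordinates. This is the origin of the constant
    \<open>1 / (3 * N\<^sup>2)\<close>.\<close>
  define N where "N = norm e1 + norm e2 + norm e3"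
  have "e3 \<noteq> 0" using B33 bilinear_lzero[OF bil, of 0] by auto
  then have N: "N > 0" by (simp add: N_def add_nonneg_pos)
  have "1 / (3 * N\<^sup>2) * (norm u)\<^sup>2 \<le> B u u + 2 * (B u e3)\<^sup>2" for u
  proof -
    have "u \<in> span {e1, e2, e3}" using sp by simp
    then obtain a b c where "u - a *\<^sub>R e1 - b *\<^sub>R e2 - c *\<^sub>R e3 = 0"
      unfolding span_breakdown_eq by auto
    then have u: "u = a *\<^sub>R e1 + b *\<^sub>R e2 + c *\<^sub>R e3" by (simp add: algebra_simps)
    note expand = bilinear_ladd[OF bil] bilinear_radd[OF bil] bilinear_lmul[OF bil]
      bilinear_rmul[OF bil]
    \<comment> \<open>In these coordinates \<open>B u u + 2 * (B u e3)\<^sup>2\<close> is the sum of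
      the three squares.\<close>
    have Buu: "B u u = a\<^sup>2 + b\<^sup>2 - c\<^sup>2" and Bue: "B u e3 = - c"
      by (auto simp: u expand B11 B22 B33 B12 B13 B23 sym[of e2 e1] sym[of e3 e1] sym[of e3 e2]
          power2_eq_square)
    define m where "m = \<bar>a\<bar> + \<bar>b\<bar> + \<bar>c\<bar>"
    have "norm u \<le> \<bar>a\<bar> * norm e1 + \<bar>b\<bar> * norm e2 + \<bar>c\<bar> * norm e3"
      unfolding u by (intro norm_triangle_le add_mono) auto
    also have "\<dots> \<le> m * norm e1 + m * norm e2 + m * norm e3"
      by (intro add_mono mult_right_mono) (auto simp: m_def)
    also have "\<dots> = m * N" by (simp add: N_def algebra_simps)
    finally have "(norm u)\<^sup>2 \<le> (m * N)\<^sup>2" by (intro power_mono) auto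
    moreover have "m\<^sup>2 \<le> 3 * (a\<^sup>2 + b\<^sup>2 + c\<^sup>2)"
    proof -
      have "0 \<le> (\<bar>a\<bar> - \<bar>b\<bar>)\<^sup>2 + (\<bar>b\<bar> - \<bar>c\<bar>)\<^sup>2 + (\<bar>a\<bar> - \<bar>c\<bar>)\<^sup>2" by simp
      also have "\<dots> = 3 * (a\<^sup>2 + b\<^sup>2 + c\<^sup>2) - m\<^sup>2"
        by (simp add: m_def power2_eq_square algebra_simps)
      finally show ?thesis by simp
    qed
    ultimately have "(norm u)\<^sup>2 \<le> 3 * (a\<^sup>2 + b\<^sup>2 + c\<^sup>2) * N\<^sup>2"
      by (smt (verit) mult_right_mono power_mult_distrib zero_le_power2)
    then show ?thesis using N by (simp add: Buu Bue field_simps)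
  qed
  moreover have "1 / (3 * N\<^sup>2) > 0" using N by simp
  ultimately show thesis using that B33 by blast
qed

text \<open>All combinations of two orthogonal null vectors are null. One of them is also orthogonal
  to the timelike vector \<open>x\<close>, and positive definiteness of the sign-reversed form
  forces it to vanish.\<close>

lemma null_vectors_orthogonal_imp_parallel:
  assumes B: "lorentzian B" and u: "B u u = 0" and v: "v \<in> null_vectors B" and uv: "B u v = 0"
  obtains k where "u = k *\<^sub>R v"
proof -
  note bil = lorentzian_bilinear[OF B]
  obtain x c where c: "c > 0" and pos: "\<And>u. c * (norm u)\<^sup>2 \<le> B u u + 2 * (B u x)\<^sup>2"
    by (rule lorentzian_positive_definite[OF B]) blast
  have zero: "w = 0" if "B w w = 0" "B w x = 0" for w
    using pos[of w] c that by (simp add: mult_le_0_iff)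
  have vx: "B v x \<noteq> 0" using zero[of v] v by (auto simp: null_vectors_def)
  \<comment> \<open>Chosen so that \<open>u - k *\<^sub>R v\<close> is orthogonal to
    \<open>x\<close>.\<close>
  define k where "k = B u x / B v x"
  have "u - k *\<^sub>R v = 0"
  proof (rule zero)
    show "B (u - k *\<^sub>R v) (u - k *\<^sub>R v) = 0" using u v uv lorentzian_commute[OF B, of v u]
      by (simp add: bilinear_lsub[OF bil] bilinear_rsub[OF bil] bilinear_lmul[OF bil]
          bilinear_rmul[OF bil] null_vectors_def)
    show "B (u - k *\<^sub>R v) x = 0"
      using vx by (simp add: bilinear_lsub[OF bil] bilinear_lmul[OF bil] k_def)
  qed
  then have "u = k *\<^sub>R v" by simp
  then show thesis by (rule that)
qed

section \<open>Boundedness and finiteness in the orthogonal group of the form\<close>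

lemma SO_form_preserves: "A \<in> SO_form B \<Longrightarrow> B (A *v u) (A *v v) = B u v"
  by (simp add: SO_form_def)

text \<open>Of the two terms of the Euclidean form at \<open>A *v u\<close>, the first is
  \<open>B u u\<close> by invariance and the second involves
  \<open>B (A *v u) x = B u (A' *v x)\<close>. A bound on the single vector \<open>A' *v x\<close>
  therefore controls the whole matrix \<open>A\<close>.\<close>

lemma SO_form_bounded:
  assumes B: "lorentzian B" and c: "c > 0"
    and pos: "\<And>u. c * (norm u)\<^sup>2 \<le> B u u + 2 * (B u x)\<^sup>2"
  obtains K where "K \<ge> 0"
    "\<And>A A' u. \<lbrakk>A \<in> SO_form B; A ** A' = mat 1; norm (A' *v x) \<le> R\<rbrakk> \<Longrightarrow> norm (A *v u) \<le> K * norm u"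
proof -
  obtain M where M: "M > 0" "\<And>u w. \<bar>B u w\<bar> \<le> M * norm u * norm w"
    using bilinear_bounded_pos[OF lorentzian_bilinear[OF B]] by auto
  \<comment> \<open>Read off from \<open>c * (norm (A *v u))\<^sup>2 \<le> M * (norm u)\<^sup>2 + 2
    * (M * norm u * R)\<^sup>2\<close>, the estimate obtained below.\<close>
  define K where "K = sqrt ((M + 2 * (M * R)\<^sup>2) / c)"
  have K2: "K\<^sup>2 = (M + 2 * (M * R)\<^sup>2) / c" using M(1) c by (simp add: K_def)
  have K: "K \<ge> 0" using M(1) c by (simp add: K_def)
  have "norm (A *v u) \<le> K * norm u"
    if A: "A \<in> SO_form B" and AA': "A ** A' = mat 1" and R: "norm (A' *v x) \<le> R" for A A' u
  proof -
    have "B (A *v u) x = B (A *v u) (A *v (A' *v x))"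
      by (simp add: matrix_vector_mul_assoc AA')
    then have Bx: "B (A *v u) x = B u (A' *v x)" using A by (simp add: SO_form_def)
    have "\<bar>B u (A' *v x)\<bar> \<le> M * norm u * norm (A' *v x)" by (rule M)
    also have "\<dots> \<le> M * norm u * R" using M(1) R by (intro mult_left_mono) auto
    finally have "\<bar>B u (A' *v x)\<bar>\<^sup>2 \<le> (M * norm u * R)\<^sup>2" by (intro power_mono) auto
    moreover have "B u u \<le> M * (norm u)\<^sup>2" using M(2)[of u u] by (simp add: power2_eq_square mult.assoc)
    moreover have "B (A *v u) (A *v u) = B u u" using A by (simp add: SO_form_def)
    ultimately have "c * (norm (A *v u))\<^sup>2 \<le> M * (norm u)\<^sup>2 + 2 * (M * norm u * R)\<^sup>2"
      using pos[of "A *v u"] Bx by simp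
    then have "(norm (A *v u))\<^sup>2 \<le> (K * norm u)\<^sup>2"
      using c by (simp add: power_mult_distrib K2 field_simps)
    then show ?thesis using K by (meson mult_nonneg_nonneg norm_ge_zero power2_le_imp_le)
  qed
  then show thesis using K that by blast
qed

text \<open>Proper discontinuity on the hyperboloid: a bound on the image of one timelike vector bounds
  both a matrix of the group and its inverse, and then discreteness at the identity spreads to a
  uniform separation of such matrices.\<close>

lemma finite_discrete_SO_form:
  assumes B: "lorentzian B" and c: "c > 0"
    and pos: "\<And>u. c * (norm u)\<^sup>2 \<le> B u u + 2 * (B u x)\<^sup>2"
    and G: "G \<subseteq> SO_form B" and disc: "discrete G" and one: "mat 1 \<in> G"
    and mult: "\<And>A C. \<lbrakk>A \<in> G; C \<in> G\<rbrakk> \<Longrightarrow> A ** C \<in> G"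
    and inv: "\<And>A. A \<in> G \<Longrightarrow> \<exists>A'\<in>G. A ** A' = mat 1 \<and> A' ** A = mat 1"
  shows "finite {A \<in> G. norm (A *v x) \<le> R}" (is "finite ?S")
proof -
  obtain K where K: "K \<ge> 0" and Kb: "\<And>A A' u. \<lbrakk>A \<in> SO_form B; A ** A' = mat 1;
      norm (A' *v x) \<le> R\<rbrakk> \<Longrightarrow> norm (A *v u) \<le> K * norm u"
    using SO_form_bounded[OF B c pos] by metis
  \<comment> \<open>\<open>K\<close> bounds the inverses of elements of the set, since the element
    itself plays the part of \<open>A'\<close> there. Hence an inverse moves \<open>x\<close> to
    norm at most \<open>K * norm x\<close>, and under this condition \<open>L\<close> bounds the
    elements themselves.\<close>
  obtain L where Lb: "\<And>A A' u. \<lbrakk>A \<in> SO_form B; A ** A' = mat 1;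
      norm (A' *v x) \<le> K * norm x\<rbrakk> \<Longrightarrow> norm (A *v u) \<le> L * norm u"
    using SO_form_bounded[OF B c pos] by metis
  obtain d where d: "d > 0" and iso: "\<And>A. A \<in> G \<Longrightarrow> dist (mat 1) A < d \<Longrightarrow> A = mat 1"
    using discreteD[OF disc one] by (auto simp: isolated_in_dist_Ex_iff)
  have inverse_bound: "norm (A' *v u) \<le> K * norm u"
    if "A \<in> ?S" "A' \<in> G" "A' ** A = mat 1" for A A' u
    using Kb[of A' A u] that G by auto
  have bdd: "bounded ?S"
  proof (rule boundedI)
    fix A assume A: "A \<in> ?S"
    then obtain A' where A': "A' \<in> G" "A ** A' = mat 1" "A' ** A = mat 1" using inv by blast
    have "norm (A *v u) \<le> L * norm u" for u
      using Lb[of A A' u] A A' G inverse_bound[OF A A'(1,3)] by auto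
    then show "norm A \<le> real CARD(3) * real CARD(3) * L" by (rule norm_matrix_le)
  qed
  have "uniform_discrete ?S"
    unfolding uniform_discrete_def
  \<comment> \<open>The factor 9 comes from \<open>norm_matrix_le\<close> for 3 by 3 matrices;
    adding 1 keeps the denominator positive when \<open>K = 0\<close>.\<close>
  proof (intro exI[of _ "d / (9 * K + 1)"] conjI ballI impI)
    show "0 < d / (9 * K + 1)" using d K by simp
    fix A C assume A: "A \<in> ?S" and C: "C \<in> ?S" and AC: "dist A C < d / (9 * K + 1)"
    obtain A' where A': "A' \<in> G" "A ** A' = mat 1" "A' ** A = mat 1" using inv A by blast
    have "norm ((A' ** C - mat 1) *v u) \<le> K * norm (C - A) * norm u" for u
    proof -
      \<comment> \<open>As \<open>A' ** A = mat 1\<close>, the difference is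
        \<open>A' ** (C - A)\<close>, and \<open>A'\<close> is bounded by \<open>K\<close>. Thus
        close \<open>A\<close> and \<open>C\<close> give a group element \<open>A' ** C\<close>
        close to the identity.\<close>
      have "(A' ** C - mat 1) *v u = A' *v ((C - A) *v u)"
        by (simp add: matrix_vector_mult_diff_rdistrib matrix_vector_mult_diff_distrib
            matrix_vector_mul_assoc A')
      then have "norm ((A' ** C - mat 1) *v u) \<le> K * norm ((C - A) *v u)"
        using inverse_bound[OF A A'(1,3)] by simp
      also have "\<dots> \<le> K * (norm (C - A) * norm u)"
        by (intro mult_left_mono norm_matrix_vector_mult_le K)
      finally show ?thesis by (simp add: mult.assoc)
    qed
    then have "norm (A' ** C - mat 1) \<le> real CARD(3) * real CARD(3) * (K * norm (C - A))"
      by (rule norm_matrix_le)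
    also have "\<dots> \<le> (9 * K + 1) * norm (C - A)" by (simp add: algebra_simps)
    also have "\<dots> < d" using AC K by (simp add: dist_norm norm_minus_commute pos_less_divide_eq mult.commute)
    finally have "A' ** C = mat 1"
      using iso[of "A' ** C"] mult A'(1) C by (simp add: dist_norm norm_minus_commute)
    then show "A = C" using A'(2) by (metis matrix_mul_assoc matrix_mul_lid matrix_mul_rid)
  qed
  then show ?thesis using bdd uniform_discrete_finite_iff by blast
qed

section \<open>Affine groups and the null bundle\<close>

text \<open>Only the group laws under composition are recorded, so that the structure
  \<open>BijGroup\<close> is unpacked once, in
  \<open>margulis_spacetime_affine_group\<close>.\<close>

locale affine_group =
  fixes \<Gamma> :: "(real^3 \<Rightarrow> real^3) set"
  assumes affine: "\<gamma> \<in> \<Gamma> \<Longrightarrow> affine_map \<gamma>"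
    and id_mem: "id \<in> \<Gamma>"
    and comp_mem: "\<lbrakk>\<gamma> \<in> \<Gamma>; \<delta> \<in> \<Gamma>\<rbrakk> \<Longrightarrow> \<gamma> \<circ> \<delta> \<in> \<Gamma>"
    and inverse_mem: "\<gamma> \<in> \<Gamma> \<Longrightarrow> \<exists>\<delta>\<in>\<Gamma>. \<gamma> \<circ> \<delta> = id \<and> \<delta> \<circ> \<gamma> = id"
begin

section \<open>Linear parts as a homomorphism\<close>

lemma affine_eq:
  assumes "\<gamma> \<in> \<Gamma>"
  shows "\<gamma> p = linear_part \<gamma> *v p + \<gamma> 0"
proof -
  obtain A b where "\<And>p. \<gamma> p = A *v p + b" using affine[OF assms] by (auto simp: affine_map_def)
  then show ?thesis using linear_part_affine[of \<gamma> A b] by simp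
qed

lemma linear_part_comp:
  assumes "\<gamma> \<in> \<Gamma>" "\<delta> \<in> \<Gamma>"
  shows "linear_part (\<gamma> \<circ> \<delta>) = linear_part \<gamma> ** linear_part \<delta>"
proof (rule linear_part_affine)
  fix p
  show "(\<gamma> \<circ> \<delta>) p = (linear_part \<gamma> ** linear_part \<delta>) *v p + \<gamma> (\<delta> 0)"
    using affine_eq[OF assms(1), of "\<delta> p"] affine_eq[OF assms(1), of "\<delta> 0"]
      affine_eq[OF assms(2), of p]
    by (simp add: matrix_vector_right_distrib matrix_vector_mul_assoc)
qed

lemma linear_part_id: "linear_part id = mat 1"
  by (rule linear_part_affine[where b = 0]) simp

lemma linear_part_inverse:
  assumes "\<gamma> \<in> \<Gamma>"
  obtains \<delta> where "\<delta> \<in> \<Gamma>" "\<gamma> \<circ> \<delta> = id" "\<delta> \<circ> \<gamma> = id"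
    "linear_part \<gamma> ** linear_part \<delta> = mat 1" "linear_part \<delta> ** linear_part \<gamma> = mat 1"
  using inverse_mem[OF assms] linear_part_comp[OF assms] linear_part_comp[OF _ assms] linear_part_id
  by metis

section \<open>Orbits in the tangent bundle and the quotient topology\<close>

lemma tangent_action_comp:
  "\<lbrakk>\<gamma> \<in> \<Gamma>; \<delta> \<in> \<Gamma>\<rbrakk> \<Longrightarrow> tangent_action (\<gamma> \<circ> \<delta>) x = tangent_action \<gamma> (tangent_action \<delta> x)"
  by (simp add: tangent_action_def split_def linear_part_comp matrix_vector_mul_assoc)

lemma tangent_action_id [simp]: "tangent_action id x = x"
  by (simp add: tangent_action_def split_def linear_part_id)

lemma mem_orbit_tangent_action: "x \<in> orbit \<Gamma> tangent_action x"
  unfolding orbit_def using id_mem by (rule image_eqI[rotated]) simp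

lemma orbit_tangent_action:
  assumes "\<gamma> \<in> \<Gamma>"
  shows "orbit \<Gamma> tangent_action (tangent_action \<gamma> x) = orbit \<Gamma> tangent_action x"
proof -
  obtain \<delta> where \<delta>: "\<delta> \<in> \<Gamma>" "\<delta> \<circ> \<gamma> = id" using linear_part_inverse[OF assms] by metis
  have "tangent_action \<eta> x \<in> orbit \<Gamma> tangent_action (tangent_action \<gamma> x)" if "\<eta> \<in> \<Gamma>" for \<eta>
  proof -
    have "tangent_action (\<eta> \<circ> \<delta>) (tangent_action \<gamma> x) = tangent_action \<eta> x"
      using that \<delta> assms by (metis comp_assoc comp_id comp_mem tangent_action_comp)
    then show ?thesis unfolding orbit_def using comp_mem[OF that \<delta>(1)] by (metis imageI)
  qed
  moreover have "tangent_action \<eta> (tangent_action \<gamma> x) \<in> orbit \<Gamma> tangent_action x" if "\<eta> \<in> \<Gamma>" for \<eta>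
    using comp_mem[OF that assms] tangent_action_comp[OF that assms] unfolding orbit_def
    by (metis imageI)
  ultimately show ?thesis by (auto simp: orbit_def)
qed

lemma orbit_tangent_action_eqD:
  assumes "orbit \<Gamma> tangent_action x = orbit \<Gamma> tangent_action y"
  obtains \<gamma> where "\<gamma> \<in> \<Gamma>" "y = tangent_action \<gamma> x"
  using mem_orbit_tangent_action[of y] assms unfolding orbit_def by auto

text \<open>The linear part preserves the form, and being invertible it keeps nonzero vectors
  nonzero.\<close>

lemma tangent_action_null_bundle:
  assumes "\<gamma> \<in> \<Gamma>" "linear_part ` \<Gamma> \<subseteq> SO_form B" "x \<in> UNIV \<times> null_vectors B"
  shows "tangent_action \<gamma> x \<in> UNIV \<times> null_vectors B"
proof -
  obtain p v where x: "x = (p, v)" "v \<noteq> 0" "B v v = 0"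
    using assms(3) by (auto simp: null_vectors_def)
  obtain \<delta> where "linear_part \<delta> ** linear_part \<gamma> = mat 1"
    using linear_part_inverse[OF assms(1)] by metis
  then have "linear_part \<gamma> *v v \<noteq> 0"
    using x(2) by (metis matrix_vector_mul_assoc matrix_vector_mul_lid matrix_vector_mult_0_right)
  then show ?thesis using assms x by (auto simp: tangent_action_def null_vectors_def SO_form_def)
qed

lemma continuous_on_tangent_action:
  assumes "\<gamma> \<in> \<Gamma>"
  shows "continuous_on S (tangent_action \<gamma>)"
proof -
  have "tangent_action \<gamma> = (\<lambda>x. (linear_part \<gamma> *v fst x + \<gamma> 0, linear_part \<gamma> *v snd x))"
    by (rule ext) (simp add: tangent_action_def split_def affine_eq[OF assms, symmetric])
  moreover have "continuous_on S (\<lambda>x. (linear_part \<gamma> *v fst x + \<gamma> 0, linear_part \<gamma> *v snd x))"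
    by (intro continuous_intros bounded_linear.continuous_on[OF matrix_vector_mul_bounded_linear])
  ultimately show ?thesis by simp
qed

text \<open>The projection to the orbit space is open: the saturation of an open set is the union of
  its preimages under the group elements, each of which acts continuously.\<close>

lemma openin_null_bundle_image:
  assumes SO: "linear_part ` \<Gamma> \<subseteq> SO_form B" and W: "open W"
  shows "openin (null_bundle B \<Gamma>)
    (orbit \<Gamma> tangent_action ` ((UNIV \<times> null_vectors B) \<inter> W))"
proof -
  let ?D = "(UNIV :: (real^3) set) \<times> null_vectors B"
  have "{x \<in> ?D. orbit \<Gamma> tangent_action x \<in> orbit \<Gamma> tangent_action ` (?D \<inter> W)}
      = (\<Union>\<gamma>\<in>\<Gamma>. ?D \<inter> tangent_action \<gamma> -` W)" (is "?L = ?R")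
  proof (intro equalityI subsetI)
    fix x assume "x \<in> ?L"
    then obtain y where x: "x \<in> ?D" and y: "y \<in> W"
      and eq: "orbit \<Gamma> tangent_action x = orbit \<Gamma> tangent_action y"
      by (elim CollectE conjE imageE IntE)
    obtain \<gamma> where "\<gamma> \<in> \<Gamma>" "y = tangent_action \<gamma> x" by (rule orbit_tangent_action_eqD[OF eq])
    then show "x \<in> ?R" using x y by (intro UN_I IntI vimageI2) auto
  next
    fix x assume "x \<in> ?R"
    then obtain \<gamma> where \<gamma>: "\<gamma> \<in> \<Gamma>" and x: "x \<in> ?D" and Wx: "x \<in> tangent_action \<gamma> -` W"
      by (elim UN_E IntE)
    show "x \<in> ?L"
    proof (intro CollectI conjI image_eqI IntI)
      show "orbit \<Gamma> tangent_action x = orbit \<Gamma> tangent_action (tangent_action \<gamma> x)"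
        using orbit_tangent_action[OF \<gamma>] by simp
    qed (use \<gamma> x vimageD[OF Wx] tangent_action_null_bundle[OF \<gamma> SO] in auto)
  qed
  moreover have "openin (top_of_set ?D) (?D \<inter> tangent_action \<gamma> -` W)" if "\<gamma> \<in> \<Gamma>" for \<gamma>
    using continuous_on_tangent_action[OF that] W by (rule continuous_openin_preimage_gen)
  ultimately have "openin (top_of_set ?D)
      {x \<in> ?D. orbit \<Gamma> tangent_action x \<in> orbit \<Gamma> tangent_action ` (?D \<inter> W)}"
    by (metis (no_types, lifting) openin_Union imageE)
  then show ?thesis
    unfolding null_bundle_def openin_quotient_topology by (simp add: image_mono)
qed

text \<open>Recurrence lifted to the cover. The projection of a product of balls is an open
  neighborhood of the orbit, and a return to it in the quotient is a return upstairs up to a deck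
  transformation.\<close>

lemma recurrent_null_bundleD:
  assumes SO: "linear_part ` \<Gamma> \<subseteq> SO_form B" and v: "v \<in> null_vectors B"
    and rec: "recurrent (null_bundle B \<Gamma>) geodesic_flow (orbit \<Gamma> tangent_action (p, v))"
    and e: "e > 0" and T: "T > 0"
  obtains \<gamma> t p1 v1 p2 v2 where "\<gamma> \<in> \<Gamma>" "t \<ge> T" "p2 = \<gamma> (p1 + t *\<^sub>R v1)" "v2 = linear_part \<gamma> *v v1"
    "dist p1 p < e" "dist v1 v < e" "dist p2 p < e" "dist v2 v < e"
proof -
  let ?q = "orbit \<Gamma> tangent_action" and ?O = "ball p e \<times> ball v e"
  define U where "U = ?q ` ((UNIV \<times> null_vectors B) \<inter> ?O)"
  have "openin (null_bundle B \<Gamma>) U"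
    unfolding U_def by (intro openin_null_bundle_image SO open_Times) auto
  moreover have "?q (p, v) \<in> U" using v e by (auto simp: U_def)
  ultimately obtain t where t: "t \<ge> T" "geodesic_flow t ` U \<inter> U \<noteq> {}"
    using rec T unfolding recurrent_def by blast
  then obtain x y where x: "x \<in> ?O" and y: "y \<in> ?O"
    and xy: "geodesic_flow t (?q x) = ?q y"
    unfolding U_def by blast
  obtain p1 v1 p2 v2 where "x = (p1, v1)" "y = (p2, v2)" by fastforce
  then have 1: "(p1, v1) \<in> ?O" and 2: "(p2, v2) \<in> ?O"
    and "geodesic_flow t (?q (p1, v1)) = ?q (p2, v2)"
    using x y xy by auto
  \<comment> \<open>The induced flow takes the orbit of a point to the orbit of the flowed
    point.\<close>
  then have "?q (p1 + t *\<^sub>R v1, v1) = ?q (p2, v2)"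
    using geodesic_flow_orbit[of \<Gamma> t "(p1, v1)"] affine by (auto simp: lifted_flow_def)
  then obtain \<gamma> where "\<gamma> \<in> \<Gamma>" "(p2, v2) = tangent_action \<gamma> (p1 + t *\<^sub>R v1, v1)"
    by (rule orbit_tangent_action_eqD)
  then show thesis using t(1) 1 2 by (intro that) (auto simp: tangent_action_def dist_commute)
qed

text \<open>Finiteness for the matrix group passes to the affine group because taking linear parts
  is injective on it.\<close>

lemma finite_linear_part_orbit_bounded:
  assumes B: "lorentzian B" and c: "c > 0"
    and pos: "\<And>u. c * (norm u)\<^sup>2 \<le> B u u + 2 * (B u x)\<^sup>2"
    and emb: "discretely_embedded_linear_part B \<Gamma>"
  shows "finite {\<gamma> \<in> \<Gamma>. norm (linear_part \<gamma> *v x) \<le> R}"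
proof -
  have inj: "inj_on linear_part \<Gamma>" and SO: "linear_part ` \<Gamma> \<subseteq> SO_form B"
    and disc: "discrete (linear_part ` \<Gamma>)"
    using emb by (auto simp: discretely_embedded_linear_part_def)
  have "finite {A \<in> linear_part ` \<Gamma>. norm (A *v x) \<le> R}"
  proof (rule finite_discrete_SO_form[OF B c pos SO disc])
    show "mat 1 \<in> linear_part ` \<Gamma>" 
      using imageI[OF id_mem, of linear_part] by (simp add: linear_part_id)
    show "A ** C \<in> linear_part ` \<Gamma>" if "A \<in> linear_part ` \<Gamma>" "C \<in> linear_part ` \<Gamma>" for A C
    proof -
      obtain \<gamma> \<delta> where "\<gamma> \<in> \<Gamma>" "A = linear_part \<gamma>" "\<delta> \<in> \<Gamma>" "C = linear_part \<delta>"
        using \<open>A \<in> linear_part ` \<Gamma>\<close> \<open>C \<in> linear_part ` \<Gamma>\<close> by (elim imageE)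
      then show ?thesis by (intro image_eqI[of _ _ "\<gamma> \<circ> \<delta>"] comp_mem) (simp_all add: linear_part_comp)
    qed
    show "\<exists>A'\<in>linear_part ` \<Gamma>. A ** A' = mat 1 \<and> A' ** A = mat 1"
      if A: "A \<in> linear_part ` \<Gamma>" for A
    proof -
      obtain \<gamma> where \<gamma>: "\<gamma> \<in> \<Gamma>" and A_eq: "A = linear_part \<gamma>" using A by blast
      obtain \<delta> where "\<delta> \<in> \<Gamma>" "A ** linear_part \<delta> = mat 1" "linear_part \<delta> ** A = mat 1"
        unfolding A_eq by (rule linear_part_inverse[OF \<gamma>])
      then show ?thesis by (intro bexI[of _ "linear_part \<delta>"] conjI imageI)
    qed
  qed
  then have "finite (linear_part ` {\<gamma> \<in> \<Gamma>. norm (linear_part \<gamma> *v x) \<le> R})"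
    by (rule finite_subset[rotated]) blast
  moreover have "inj_on linear_part {\<gamma> \<in> \<Gamma>. norm (linear_part \<gamma> *v x) \<le> R}"
    using inj by (rule inj_on_subset) blast
  ultimately show ?thesis by (rule finite_imageD)
qed

end

lemma margulis_spacetime_affine_group:
  assumes "margulis_spacetime \<Gamma>"
  shows "affine_group \<Gamma>"
proof
  have sub: "subgroup \<Gamma> (BijGroup UNIV)" and aff: "\<forall>\<gamma>\<in>\<Gamma>. affine_map \<gamma>"
    using assms by (auto simp: margulis_spacetime_def)
  have Bij: "\<gamma> \<in> Bij UNIV" if "\<gamma> \<in> \<Gamma>" for \<gamma>
    using subgroup.mem_carrier[OF sub that] by (simp add: BijGroup_def)
  show "affine_map \<gamma>" if "\<gamma> \<in> \<Gamma>" for \<gamma> using aff that by blast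
  show "id \<in> \<Gamma>" using subgroup.one_closed[OF sub] by (simp add: BijGroup_def id_def restrict_def)
  show "\<gamma> \<circ> \<delta> \<in> \<Gamma>" if "\<gamma> \<in> \<Gamma>" "\<delta> \<in> \<Gamma>" for \<gamma> \<delta>
    using subgroup.m_closed[OF sub that] Bij[OF that(1)] Bij[OF that(2)]
    by (simp add: BijGroup_def compose_def comp_def restrict_def)
  show "\<exists>\<delta>\<in>\<Gamma>. \<gamma> \<circ> \<delta> = id \<and> \<delta> \<circ> \<gamma> = id" if "\<gamma> \<in> \<Gamma>" for \<gamma>
  proof (intro bexI conjI)
    have bij: "bij \<gamma>" using Bij[OF that] by (simp add: Bij_def)
    show "\<gamma> \<circ> inv_into UNIV \<gamma> = id" by (rule surj_iff[THEN iffD1, OF bij_is_surj[OF bij]])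
    show "inv_into UNIV \<gamma> \<circ> \<gamma> = id" by (rule inj_iff[THEN iffD1, OF bij_is_inj[OF bij]])
    show "inv_into UNIV \<gamma> \<in> \<Gamma>"
      using subgroup.m_inv_closed[OF sub that] inv_BijGroup[OF Bij[OF that]]
      by (simp add: restrict_def)
  qed
qed

section \<open>Limit points and recurrence\<close>

lemma span_singleton_scaleR:
  fixes x :: "'a::real_vector"
  assumes "k \<noteq> 0"
  shows "span {k *\<^sub>R x} = span {x}"
  using span_image_scale[of "{x}" "\<lambda>_. k"] assms by simp

lemma line_action_span: "line_action A (span {x}) = span {A *v x}"
  unfolding line_action_def using linear_span_image[OF matrix_vector_mul_linear, of A "{x}"] by simp

text \<open>Projective convergence of the orbit of \<open>x\<close> puts orbit points into every
  neighborhood of the line of \<open>b\<close>. These points are timelike lines, hence distinct from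
  the null line, so it is a genuine accumulation point.\<close>

lemma limit_set_memI:
  fixes A :: "nat \<Rightarrow> real^3^3"
  assumes B: "lorentzian B" and G: "range A \<subseteq> G" "G \<subseteq> SO_form B" and x: "B x x = -1"
    and b: "b \<in> null_vectors B"
    and lim: "(\<lambda>n. A n *v x /\<^sub>R norm (A n *v x)) \<longlonglongrightarrow> b"
  shows "span {b} \<in> limit_set B G"
proof -
  note bil = lorentzian_bilinear[OF B]
  have b0: "b \<noteq> 0" and Bb: "B b b = 0" using b by (auto simp: null_vectors_def)
  define w where "w n = A n *v x" for n
  have Bw: "B (w n) (w n) = -1" for n
  proof -
    have "A n \<in> SO_form B" using G by blast
    then show ?thesis using x by (simp add: w_def SO_form_preserves)
  qed
  have w0: "w n \<noteq> 0" for n using Bw[of n] bilinear_lzero[OF bil, of 0] by auto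
  have "span {b} \<in> projective_plane derived_set_of (orbit G line_action (span {x}))"
    unfolding in_derived_set_of
  proof (intro conjI allI impI)
    show "span {b} \<in> topspace projective_plane"
      using b0 by (auto simp: projective_plane_def topspace_quotient_topology)
    fix T assume T: "span {b} \<in> T \<and> openin projective_plane T"
    then have "openin (top_of_set (- {0})) {u \<in> - {0}. span {u} \<in> T}"
      by (simp add: projective_plane_def openin_quotient_topology)
    then have "open {u \<in> - {0}. span {u} \<in> T}" by (subst (asm) openin_open_eq) auto
    then have "\<forall>\<^sub>F n in sequentially. w n /\<^sub>R norm (w n) \<in> {u \<in> - {0}. span {u} \<in> T}"
      by (rule topological_tendstoD[OF lim[folded w_def]]) (use b0 T in auto)
    then obtain n where "span {w n /\<^sub>R norm (w n)} \<in> T"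
      by (auto dest: eventually_happens)
    then have inT: "span {w n} \<in> T" using w0[of n] by (simp add: span_singleton_scaleR)
    have "span {w n} \<noteq> span {b}"
    proof
      assume "span {w n} = span {b}"
      then obtain k where "w n = k *\<^sub>R b" using span_base[of "w n" "{w n}"] by (auto simp: span_singleton)
      then show False using Bw[of n] Bb by (simp add: bilinear_lmul[OF bil] bilinear_rmul[OF bil])
    qed
    moreover have "span {w n} \<in> orbit G line_action (span {x})"
      using G(1) by (auto simp: orbit_def w_def line_action_span[symmetric])
    ultimately show "\<exists>y. y \<noteq> span {b} \<and> y \<in> orbit G line_action (span {x}) \<and> y \<in> T"
      using inT by blast
  qed
  moreover have "span {b} \<in> ideal_boundary B" using b0 Bb by (auto simp: ideal_boundary_def)
  moreover have "span {x} \<in> hyperbolic_plane B" using x by (auto simp: hyperbolic_plane_def)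
  ultimately show ?thesis by (auto simp: limit_set_def)
qed

text \<open>Along matrices \<open>A n\<close> with \<open>A n *v v\<^sub>n\<close> and \<open>v\<^sub>n\<close> both tending to \<open>v\<close>, the products
  \<open>B (A n\<inverse> x) v\<^sub>n = B x (A n *v v\<^sub>n)\<close> stay bounded, so a limit direction of an unbounded sequence
  \<open>A n\<inverse> x\<close> is null and orthogonal to \<open>v\<close>, hence it is the direction of \<open>v\<close>.\<close>

lemma span_mem_limit_setI:
  fixes A A' :: "nat \<Rightarrow> real^3^3"
  assumes B: "lorentzian B" and G: "range A \<subseteq> G" "range A' \<subseteq> G" "G \<subseteq> SO_form B"
    and inv: "\<And>n. A n ** A' n = mat 1"
    and x: "B x x = -1" and v: "v \<in> null_vectors B"
    and u: "u \<longlonglongrightarrow> v" and Au: "(\<lambda>n. A n *v u n) \<longlonglongrightarrow> v"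
    and unbdd: "filterlim (\<lambda>n. norm (A' n *v x)) at_top sequentially"
  shows "span {v} \<in> limit_set B G"
proof -
  note bil = lorentzian_bilinear[OF B]
  have bb: "bounded_bilinear B" using bil by (simp add: bilinear_conv_bounded_bilinear)
  define w where "w n = A' n *v x" for n
  have Bw: "B (w n) (w n) = -1" for n
  proof -
    have "A' n \<in> SO_form B" using G by blast
    then show ?thesis using x by (simp add: w_def SO_form_preserves)
  qed
  have w0: "w n \<noteq> 0" for n using Bw[of n] bilinear_lzero[OF bil, of 0] by auto
  define z where "z n = w n /\<^sub>R norm (w n)" for n
  \<comment> \<open>Compactness of the unit sphere supplies a limit direction \<open>b\<close> along
    a subsequence.\<close>
  have "z n \<in> sphere 0 1" for n using w0[of n] by (simp add: z_def)
  then obtain b r where b: "b \<in> sphere 0 1" and r: "strict_mono r" and zb: "(z \<circ> r) \<longlonglongrightarrow> b"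
    using compact_sphere[of "0 :: real^3" 1] unfolding compact_def by metis
  have sub: "(\<lambda>n. f (r n)) \<longlonglongrightarrow> l" if "f \<longlonglongrightarrow> l" for f :: "nat \<Rightarrow> 'a::topological_space" and l
    using LIMSEQ_subseq_LIMSEQ[OF that r] by (simp add: comp_def)
  have zb': "(\<lambda>n. z (r n)) \<longlonglongrightarrow> b" using zb by (simp add: comp_def)
  have inv0: "(\<lambda>n. inverse (norm (w n))) \<longlonglongrightarrow> 0"
    using unbdd unfolding w_def by (rule tendsto_inverse_0_at_top)
  \<comment> \<open>All \<open>w n\<close> lie on the hyperboloid, where \<open>B\<close> is -1,
    while their norms tend to infinity. After normalization the values tend to 0, so
    \<open>b\<close> is null.\<close>
  have "(\<lambda>n. B (z n) (z n)) = (\<lambda>n. - (inverse (norm (w n)))\<^sup>2)"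
    by (rule ext) (simp add: z_def bilinear_lmul[OF bil] bilinear_rmul[OF bil] Bw power2_eq_square)
  moreover have "(\<lambda>n. - (inverse (norm (w n)))\<^sup>2) \<longlonglongrightarrow> - 0\<^sup>2" by (intro tendsto_intros inv0)
  ultimately have "(\<lambda>n. B (z n) (z n)) \<longlonglongrightarrow> 0" by simp
  then have "(\<lambda>n. B (z (r n)) (z (r n))) \<longlonglongrightarrow> 0"
    using LIMSEQ_subseq_LIMSEQ[OF _ r] by (fastforce simp: comp_def)
  moreover have "(\<lambda>n. B (z (r n)) (z (r n))) \<longlonglongrightarrow> B b b"
    by (rule bounded_bilinear.tendsto[OF bb zb' zb'])
  ultimately have Bbb: "B b b = 0" using LIMSEQ_unique by blast
  have "B (w n) (u n) = B x (A n *v u n)" for n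
  proof -
    have "A n \<in> SO_form B" using G by blast
    then have "B (w n) (u n) = B (A n *v w n) (A n *v u n)" by (simp add: SO_form_preserves)
    then show ?thesis by (simp add: w_def matrix_vector_mul_assoc inv)
  qed
  then have "(\<lambda>n. B (z n) (u n)) = (\<lambda>n. inverse (norm (w n)) * B x (A n *v u n))"
    by (simp add: z_def bilinear_lmul[OF bil])
  moreover have "(\<lambda>n. inverse (norm (w n)) * B x (A n *v u n)) \<longlonglongrightarrow> 0 * B x v"
    by (intro tendsto_mult inv0 bounded_bilinear.tendsto[OF bb] tendsto_const Au)
  ultimately have "(\<lambda>n. B (z n) (u n)) \<longlonglongrightarrow> 0" by simp
  then have "(\<lambda>n. B (z (r n)) (u (r n))) \<longlonglongrightarrow> 0"
    using LIMSEQ_subseq_LIMSEQ[OF _ r] by (fastforce simp: comp_def)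
  moreover have "(\<lambda>n. B (z (r n)) (u (r n))) \<longlonglongrightarrow> B b v"
    using LIMSEQ_subseq_LIMSEQ[OF u r]
    by (intro bounded_bilinear.tendsto[OF bb zb']) (simp add: comp_def)
  ultimately have Bbv: "B b v = 0" using LIMSEQ_unique by blast
  obtain k where k: "b = k *\<^sub>R v" using null_vectors_orthogonal_imp_parallel[OF B Bbb v Bbv] .
  have "b \<noteq> 0" using b by auto
  then have "b \<in> null_vectors B" and "k \<noteq> 0" using Bbb k by (auto simp: null_vectors_def)
  have "span {b} \<in> limit_set B G"
  proof (rule limit_set_memI[where A = "\<lambda>n. A' (r n)"])
    show "(\<lambda>n. A' (r n) *v x /\<^sub>R norm (A' (r n) *v x)) \<longlonglongrightarrow> b" using zb' by (simp add: z_def w_def)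
  qed (use G B x \<open>b \<in> null_vectors B\<close> in auto)
  then show ?thesis using k \<open>k \<noteq> 0\<close> by (simp add: span_singleton_scaleR)
qed

section \<open>Escape of the returning group elements\<close>

theorem mainTheorem2:
  fixes \<Gamma> :: "(real^3 \<Rightarrow> real^3) set"
    and B :: "real^3 \<Rightarrow> real^3 \<Rightarrow> real"
    and v p :: "real^3"
  assumes "margulis_spacetime \<Gamma>"
    and "lorentzian B"
    and "discretely_embedded_linear_part B \<Gamma>"
    and "compactin (hyperbolic_surface B (linear_part ` \<Gamma>)) (convex_core B (linear_part ` \<Gamma>))"
    and "v \<in> null_vectors B"
    and "span {v} \<notin> limit_set B (linear_part ` \<Gamma>)"
  shows "\<not> recurrent (null_bundle B \<Gamma>) geodesic_flow (orbit \<Gamma> tangent_action (p, v))"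
proof
  assume rec: "recurrent (null_bundle B \<Gamma>) geodesic_flow (orbit \<Gamma> tangent_action (p, v))"
  interpret affine_group \<Gamma> using assms(1) by (rule margulis_spacetime_affine_group)
  have SO: "linear_part ` \<Gamma> \<subseteq> SO_form B"
    using assms(3) by (simp add: discretely_embedded_linear_part_def)
  obtain x c where x: "B x x = -1" and c: "c > 0"
    and pos: "\<And>u. c * (norm u)\<^sup>2 \<le> B u u + 2 * (B u x)\<^sup>2"
    using lorentzian_positive_definite[OF assms(2)] by metis
  \<comment> \<open>The \<open>n\<close>-th return uses radius \<open>1 / Suc n\<close> and time
    bound \<open>Suc n\<close>, both positive already at \<open>n = 0\<close>.\<close>
  have "\<exists>\<gamma> t p1 v1. \<gamma> \<in> \<Gamma> \<and> t \<ge> real (Suc n) \<and> dist p1 p < 1 / Suc n \<and> dist v1 v < 1 / Suc n \<and>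
      dist (\<gamma> (p1 + t *\<^sub>R v1)) p < 1 / Suc n \<and> dist (linear_part \<gamma> *v v1) v < 1 / Suc n" for n
    using recurrent_null_bundleD[OF SO assms(5) rec, of "1 / Suc n" "real (Suc n)"]
    by (metis divide_pos_pos of_nat_0_less_iff zero_less_Suc zero_less_one)
  then obtain \<gamma> t p1 v1 where \<gamma>: "\<And>n. \<gamma> n \<in> \<Gamma>" and t: "\<And>n. t n \<ge> real (Suc n)"
    and p1: "\<And>n. dist (p1 n) p < 1 / Suc n" and v1: "\<And>n. dist (v1 n) v < 1 / Suc n"
    and p2: "\<And>n. dist (\<gamma> n (p1 n + t n *\<^sub>R v1 n)) p < 1 / Suc n"
    and v2: "\<And>n. dist (linear_part (\<gamma> n) *v v1 n) v < 1 / Suc n"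
    by metis
  have "\<exists>\<delta>\<in>\<Gamma>. \<delta> \<circ> \<gamma> n = id \<and> linear_part (\<gamma> n) ** linear_part \<delta> = mat 1" for n
    using linear_part_inverse[OF \<gamma>[of n]] by metis
  then obtain \<delta> where \<delta>: "\<And>n. \<delta> n \<in> \<Gamma>" "\<And>n. \<delta> n \<circ> \<gamma> n = id"
    "\<And>n. linear_part (\<gamma> n) ** linear_part (\<delta> n) = mat 1"
    by metis
  have lim: "f \<longlonglongrightarrow> l" if "\<And>n. dist (f n) l < 1 / Suc n" for f :: "nat \<Rightarrow> real^3" and l
    by (rule metric_tendsto_imp_tendsto[OF LIMSEQ_inverse_real_of_nat])
      (use that in \<open>simp add: inverse_eq_divide less_imp_le del: of_nat_Suc\<close>)
  have v0: "norm v > 0" using assms(5) by (simp add: null_vectors_def)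
  have v1_lim: "v1 \<longlonglongrightarrow> v" using v1 by (rule lim)
  \<comment> \<open>The vectors \<open>v1 n\<close> tend to a nonzero vector, so the length of the
    displacement grows with \<open>t n\<close>.\<close>
  have "filterlim (\<lambda>n. norm (t n *\<^sub>R v1 n)) at_top sequentially"
  proof -
    have "filterlim (\<lambda>n. real (Suc n)) at_top sequentially"
      by (rule filterlim_compose[OF filterlim_real_sequentially filterlim_Suc])
    then have "filterlim t at_top sequentially"
      by (rule filterlim_at_top_mono) (simp add: t del: of_nat_Suc)
    then have "filterlim (\<lambda>n. norm (v1 n) * t n) at_top sequentially"
      using tendsto_norm[OF v1_lim] v0 filterlim_tendsto_pos_mult_at_top by blast
    then show ?thesis
      by (rule filterlim_at_top_mono) (simp add: mult.commute mult_right_mono)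
  qed
  \<comment> \<open>A finite set of maps takes the ball about \<open>p\<close> to a bounded set, but \<open>\<delta> n\<close> moves a point of
    this ball far away.\<close>
  have unbdd: "\<forall>\<^sub>F n in sequentially. \<delta> n \<notin> F" if "finite F" "F \<subseteq> \<Gamma>" for F
  proof -
    have "bounded (\<eta> ` cball p 1)" if "\<eta> \<in> F" for \<eta>
    proof -
      have eq: "\<eta> = (\<lambda>q. linear_part \<eta> *v q + \<eta> 0)" using affine_eq that \<open>F \<subseteq> \<Gamma>\<close> by blast
      have "continuous_on (cball p 1) \<eta>"
        by (subst eq) (intro continuous_intros)
      then show ?thesis by (intro compact_imp_bounded compact_continuous_image compact_cball)
    qed
    then have "bounded (\<Union>\<eta>\<in>F. \<eta> ` cball p 1)" using \<open>finite F\<close> by (intro bounded_UN) auto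
    then obtain M where M: "\<And>\<eta> q. \<eta> \<in> F \<Longrightarrow> q \<in> cball p 1 \<Longrightarrow> norm (\<eta> q) \<le> M"
      unfolding bounded_iff by blast
    have "\<forall>\<^sub>F n in sequentially. norm (t n *\<^sub>R v1 n) > M + (norm p + 1)"
      using \<open>filterlim (\<lambda>n. norm (t n *\<^sub>R v1 n)) at_top sequentially\<close>
      by (simp add: filterlim_at_top_dense)
    then show ?thesis
    proof (rule eventually_mono)
      fix n assume large: "norm (t n *\<^sub>R v1 n) > M + (norm p + 1)"
      \<comment> \<open>Both \<open>p1 n\<close> and the returned point then lie in the unit ball
        about \<open>p\<close>. If \<open>\<delta> n\<close> were in \<open>F\<close>, the flowed
        point would have norm at most \<open>M\<close> and its displacement from \<open>p1 n\<close>
        at most \<open>M + (norm p + 1)\<close>, against \<open>large\<close>.\<close>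
      have small: "1 / real (Suc n) \<le> 1" by simp
      show "\<delta> n \<notin> F"
      proof
        assume F: "\<delta> n \<in> F"
        have "p1 n + t n *\<^sub>R v1 n = \<delta> n (\<gamma> n (p1 n + t n *\<^sub>R v1 n))"
          using \<delta>(2)[of n] by (metis comp_apply id_apply)
        moreover have "\<gamma> n (p1 n + t n *\<^sub>R v1 n) \<in> cball p 1"
          using less_le_trans[OF p2[of n] small] by (simp add: dist_commute)
        ultimately have "norm (p1 n + t n *\<^sub>R v1 n) \<le> M" using M[OF F] by metis
        moreover have "norm (p1 n) \<le> norm p + 1"
          using less_le_trans[OF p1[of n] small] norm_triangle_sub[of "p1 n" p] by (simp add: dist_norm)
        ultimately show False
          using large norm_triangle_ineq4[of "p1 n + t n *\<^sub>R v1 n" "p1 n"] by simp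
      qed
    qed
  qed
  have "span {v} \<in> limit_set B (linear_part ` \<Gamma>)"
  proof (rule span_mem_limit_setI[where A = "\<lambda>n. linear_part (\<gamma> n)" and A' = "\<lambda>n. linear_part (\<delta> n)",
        OF assms(2) _ _ SO \<delta>(3) x assms(5) v1_lim])
    show "(\<lambda>n. linear_part (\<gamma> n) *v v1 n) \<longlonglongrightarrow> v" using v2 by (rule lim)
    \<comment> \<open>For each \<open>R\<close> only finitely many group elements move
      \<open>x\<close> to norm at most \<open>R\<close>, and by \<open>unbdd\<close> the sequence
      \<open>\<delta>\<close> eventually avoids them.\<close>
    show "filterlim (\<lambda>n. norm (linear_part (\<delta> n) *v x)) at_top sequentially"
      unfolding filterlim_at_top_dense
    proof
      fix R
      have "\<forall>\<^sub>F n in sequentially. \<delta> n \<notin> {\<gamma> \<in> \<Gamma>. norm (linear_part \<gamma> *v x) \<le> R}"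
        using finite_linear_part_orbit_bounded[OF assms(2) c pos assms(3)] by (intro unbdd) auto
      then show "\<forall>\<^sub>F n in sequentially. norm (linear_part (\<delta> n) *v x) > R"
        by (rule eventually_mono) (use \<delta>(1) in auto)
    qed
  qed (use \<gamma> \<delta>(1) in auto)
  then show False using assms(6) by blast
qed

end
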